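(* There exist a bounded measurable set $\Omega\subset\mathbb{R}^2$ and a real number $\lambda>0$ such that $\Omega$ itself is the minimizer of the functional $\Sigma\mapsto E(\Sigma,\lambda)=\mathrm{Per}(\Sigma)+\lambda\,|\Sigma\triangle\Omega|$ over measurable sets $\Sigma\subset\mathbb{R}^2$, that is, $E(\Omega,\lambda)<E(\Sigma,\lambda)$ for every measurable $\Sigma\subset\mathbb{R}^2$ with $|\Sigma\triangle\Omega|>0$, while $\Omega$ is not the union of the balls of radius $1/\lambda$ that it contains, in the sense that $$\Big|\,\Omega\setminus\bigcup\{B_{1/\lambda}(x): x\in\mathbb{R}^2,\ B_{1/\lambda}(x)\subset\Omega\}\Big|>0 .$$
   Context: $|A|$ denotes the two-dimensional Lebesgue measure of a measurable set $A\subset\mathbb{R}^2$, $\triangle$ denotes symmetric difference, $B_\rho(x)$ is the open disc of radius $\rho$ centred at $x$, and $\mathrm{Per}(\Sigma)\in[0,\infty]$ is the perimeter of $\Sigma$ (the total variation of the distributional gradient of the characteristic function $\chi_\Sigma$ on $\mathbb{R}^2$). The functional $E(\cdot,\lambda)$ is the reduction of the $L^1TV$ functional $F(u)=\int|\nabla u|\,dx+\lambda\int|u-f|\,dx$ to binary data $f=\chi_\Omega$ and $u=\chi_\Sigma$. Sets are identified when they differ by a Lebesgue null set. *)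

theory Defs
  imports "HOL-Analysis.Analysis"
begin

definition divergence :: "('a::euclidean_space \<Rightarrow> 'a) \<Rightarrow> 'a \<Rightarrow> real" where
  "divergence \<phi> x = (\<Sum>b\<in>Basis. frechet_derivative \<phi> (at x) b \<bullet> b)"

text \<open>Compactly supported vector fields of class \<open>C\<^sup>1\<close>; continuity of the derivative is with
  respect to the operator norm.\<close>

definition C1c_field :: "('a::euclidean_space \<Rightarrow> 'a) \<Rightarrow> bool" where
  "C1c_field \<phi> \<longleftrightarrow>
     (\<exists>D :: 'a \<Rightarrow> 'a \<Rightarrow>\<^sub>L 'a.
        (\<forall>x. (\<phi> has_derivative blinfun_apply (D x)) (at x)) \<and> continuous_on UNIV D) \<and>
     compact (closure {x. \<phi> x \<noteq> 0})"

text \<open>The total variation of the distributional gradient of the characteristic function, by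
  duality with test fields bounded by 1. The class of test fields is closed under negation and
  contains 0, so the truncation of negative reals by \<^const>\<open>ennreal\<close> does not change the
  supremum. The definition is only meaningful for Lebesgue measurable sets.\<close>

definition perimeter :: "'a::euclidean_space set \<Rightarrow> ennreal" where
  "perimeter S =
     (SUP \<phi> \<in> {\<phi>. C1c_field \<phi> \<and> (\<forall>x. norm (\<phi> x) \<le> 1)}.
        ennreal (LINT x:S|lebesgue. divergence \<phi> x))"

definition L1TV_energy :: "'a::euclidean_space set \<Rightarrow> real \<Rightarrow> 'a set \<Rightarrow> ennreal" where
  "L1TV_energy \<Omega> lam S = perimeter S + ennreal lam * emeasure lebesgue (sym_diff S \<Omega>)"

text \<open>Inclusion of sets identified modulo Lebesgue null sets. With pointwise inclusion of balls,
  deleting a dense null set from any \<open>\<Omega>\<close> would leave it without balls while changing neither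
  perimeter nor area.\<close>

definition ae_subset :: "'a::euclidean_space set \<Rightarrow> 'a set \<Rightarrow> bool" where
  "ae_subset A B \<longleftrightarrow> A - B \<in> null_sets lebesgue"

end

theory Submission
  imports Defs
begin

text \<open>The set is a disc of radius 40 pierced by two round holes of radius \<open>r = 12.01\<close> centred at
  \<open>(-13, 0)\<close> and \<open>(13, 0)\<close>, and \<open>lam = 1\<close>. The neck between the holes has width \<open>w = 1.98\<close>, slightly
  less than the diameter 2 of the balls in question: a unit ball inside the set cannot get through
  the neck, and it cannot even reach the points of the axis next to a hole
  (\<open>neck_uncovered\<close>).

  Minimality is shown by a calibration: a \<open>C\<^sup>1\<close> field \<open>\<phi>\<close> with compact support, \<open>|\<phi>| \<le> 1\<close> and
  \<open>|div \<phi>| \<le> 99/100 < lam\<close>, which is the outer unit normal on the boundary of the set \<open>\<Omega>\<close>. Then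
  \<open>Per \<Omega> = \<integral>\<^sub>\<Omega> div \<phi>\<close>, while \<open>Per S \<ge> \<integral>\<^sub>S div \<phi>\<close> for every \<open>S\<close>, and the two integrals differ
  by less than \<open>lam\<close> times the area of the symmetric difference
  (\<open>calibrated_set_is_strict_minimizer\<close>).

  The field is a sum of three radial fields, one for each boundary circle. Crossing the neck, its
  horizontal component has to grow from -1 to 1 over a length less than 2, so that the
  horizontal part of the divergence exceeds \<open>lam\<close> on average. It is the curvature of the holes
  that compensates for this: the two fields converge towards the centres of the
  holes, which contributes a negative vertical part, of size about \<open>1/r\<close> at a hole. The resulting
  bound on the divergence in the neck is \<open>neck_bound\<close>. Inside a
  hole the field carries a flux \<open>2\<pi>r\<close> through an area \<open>\<pi>r\<^sup>2\<close>, so the divergence there can be below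
  \<open>lam\<close> in modulus only if \<open>r > 2\<close>; the value of \<open>r\<close> leaves ample room for that.

  The perimeter of \<open>\<Omega>\<close> is bounded above without any boundary integral: for a test field \<open>\<psi>\<close>, the field
  \<open>\<phi> - \<psi>\<close> points outward from \<open>\<Omega>\<close> in a one-sided neighbourhood of each boundary circle, and for such fields the
  integral of the divergence is nonnegative by integration by parts against radial cutoff functions
  (\<open>integral_divergence_ball_nonneg\<close>).\<close>

section \<open>Directional derivatives of compactly supported functions\<close>

text \<open>The integrals of the difference quotients of \<open>f\<close> vanish by translation invariance, and the
  quotients converge dominatedly.\<close>

lemma integral_directional_derivative_0:
  fixes f :: "'a::euclidean_space \<Rightarrow> real"
  assumes der: "\<And>x. (f has_derivative f' x) (at x)"
    and cont: "continuous_on UNIV (\<lambda>x. f' x b)"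
    and supp: "\<And>x. norm x > B \<Longrightarrow> f x = 0"
  shows "integrable lborel (\<lambda>x. f' x b)" "(\<integral>x. f' x b \<partial>lborel) = 0"
proof -
  define t where "t n = 1 / real (Suc n)" for n
  have t: "0 < t n" "t n \<le> 1" for n by (auto simp: t_def)
  have t0: "t \<longlonglongrightarrow> 0" unfolding t_def using LIMSEQ_inverse_real_of_nat by (simp add: inverse_eq_divide)
  define Q where "Q n x = (f (x + t n *\<^sub>R b) - f x) / t n" for n x
  define r where "r = B + norm b"
  have contf: "continuous_on UNIV f"
    by (intro continuous_at_imp_continuous_on ballI has_derivative_continuous[OF der])
  have "compact ((\<lambda>x. f' x b) ` cball 0 (r + norm b))"
    by (intro compact_continuous_image continuous_on_subset[OF cont]) auto
  then obtain M0 where M0: "\<And>x. x \<in> cball 0 (r + norm b) \<Longrightarrow> norm (f' x b) \<le> M0"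
    by (meson bounded_iff compact_imp_bounded image_eqI)
  define M where "M = max M0 0"
  have M: "norm (f' x b) \<le> M" "M \<ge> 0" if "norm x \<le> r + norm b" for x
    using M0[of x] that by (auto simp: M_def)
  have lin: "linear (f' x)" for x using der has_derivative_linear by blast
  have bound: "norm (Q n x) \<le> M * indicator (cball 0 r) x" for n x
  proof (cases "norm x \<le> r")
    case False
    have "norm (t n *\<^sub>R b) \<le> norm b" using t[of n] by (simp add: mult_left_le_one_le)
    moreover have "norm x \<le> norm (x + t n *\<^sub>R b) + norm (t n *\<^sub>R b)"
      by (metis add_diff_cancel norm_triangle_ineq4)
    ultimately have "norm (x + t n *\<^sub>R b) > B" "norm x > B"
      using False by (auto simp: r_def intro: le_less_trans[of _ "B + norm b"])
    then show ?thesis using supp False by (auto simp: Q_def)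
  next
    case True
    have d: "((\<lambda>s. f (x + s *\<^sub>R b)) has_real_derivative f' (x + s *\<^sub>R b) b) (at s)" for s
    proof -
      have "((\<lambda>s. f (x + s *\<^sub>R b)) has_derivative (\<lambda>h. f' (x + s *\<^sub>R b) (h *\<^sub>R b))) (at s)"
        by (rule has_derivative_compose[where f = "\<lambda>s. x + s *\<^sub>R b" and g = f, OF _ der])
           (auto intro!: derivative_eq_intros)
      then show ?thesis
        unfolding has_field_derivative_def
        by (rule has_derivative_eq_rhs) (simp add: fun_eq_iff linear_cmul[OF lin] mult.commute)
    qed
    obtain z where z: "0 < z" "z < t n" "f (x + t n *\<^sub>R b) - f (x + 0 *\<^sub>R b) = (t n - 0) * f' (x + z *\<^sub>R b) b"
      using MVT2[OF t(1)[of n], of "\<lambda>s. f (x + s *\<^sub>R b)" "\<lambda>s. f' (x + s *\<^sub>R b) b"] d by blast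
    have "norm (z *\<^sub>R b) \<le> norm b" using t[of n] z by (simp add: mult_left_le_one_le)
    then have "norm (x + z *\<^sub>R b) \<le> r + norm b" using True norm_triangle_le[of x "z *\<^sub>R b"] by fastforce
    then have "norm (f' (x + z *\<^sub>R b) b) \<le> M" using M by blast
    moreover have "Q n x = f' (x + z *\<^sub>R b) b" using z t[of n] by (simp add: Q_def)
    ultimately show ?thesis using True by simp
  qed
  have lim: "(\<lambda>n. Q n x) \<longlonglongrightarrow> f' x b" for x
  proof -
    have "((\<lambda>s. f (x + s *\<^sub>R b)) has_derivative (\<lambda>h. f' x (h *\<^sub>R b))) (at 0)"
      by (rule has_derivative_compose[where f = "\<lambda>s. x + s *\<^sub>R b" and g = f and s = UNIV and x = 0, simplified])
         (auto intro!: derivative_eq_intros der)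
    then have "((\<lambda>s. f (x + s *\<^sub>R b)) has_real_derivative f' x b) (at 0)"
      unfolding has_field_derivative_def
      by (rule has_derivative_eq_rhs) (simp add: fun_eq_iff linear_cmul[OF lin] mult.commute)
    then have "((\<lambda>h. (f (x + h *\<^sub>R b) - f x) / h) \<longlongrightarrow> f' x b) (at 0)"
      by (simp add: DERIV_def)
    moreover have "filterlim t (at 0) sequentially"
      using t0 t(1) by (simp add: filterlim_at eventually_sequentially) (metis less_irrefl)
    ultimately show ?thesis unfolding Q_def by (rule filterlim_compose)
  qed
  have fm: "f \<in> borel_measurable borel" using contf by (rule borel_measurable_continuous_onI)
  have Qm: "Q n \<in> borel_measurable lborel" for n
  proof -
    have "continuous_on UNIV (Q n)" unfolding Q_def using t(1)[of n]
      by (intro continuous_intros continuous_on_compose2[OF contf]) auto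
    then show ?thesis using borel_measurable_continuous_onI by simp
  qed
  have f'm: "(\<lambda>x. f' x b) \<in> borel_measurable lborel"
    using borel_measurable_continuous_onI[OF cont] by simp
  have "integrable lborel (\<lambda>x. indicator (cball 0 B) x *\<^sub>R f x)"
    by (intro borel_integrable_compact continuous_on_subset[OF contf]) auto
  moreover have "(\<lambda>x. indicator (cball 0 B) x *\<^sub>R f x) = f"
    using supp by (fastforce simp: indicator_def)
  ultimately have fi: "integrable lborel f" by simp
  have ti: "integrable lborel (\<lambda>x. f (x + c))" "(\<integral>x. f (x + c) \<partial>lborel) = (\<integral>x. f x \<partial>lborel)" for c
  proof -
    have e: "lborel = distr lborel borel ((+) c)" by (simp add: lborel_distr_plus)
    show "integrable lborel (\<lambda>x. f (x + c))"
      using fi by (subst (asm) e) (simp add: integrable_distr_eq fm add.commute)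
    show "(\<integral>x. f (x + c) \<partial>lborel) = (\<integral>x. f x \<partial>lborel)"
      by (subst (2) e) (simp add: integral_distr fm add.commute)
  qed
  have Q0: "(\<integral>x. Q n x \<partial>lborel) = 0" for n
    using ti[of "t n *\<^sub>R b"] fi by (simp add: Q_def)
  have Mi: "integrable lborel (\<lambda>x. M * indicator (cball 0 r) x :: real)"
    by (intro integrable_mult_right integrable_real_indicator)
      (use emeasure_lborel_cball_finite[of 0 r] in \<open>auto simp: infinity_ennreal_def\<close>)
  show "integrable lborel (\<lambda>x. f' x b)"
    by (rule integrable_dominated_convergence[where s = Q, OF f'm Qm Mi]) (use lim bound in auto)
  have "(\<lambda>n. \<integral>x. Q n x \<partial>lborel) \<longlonglongrightarrow> (\<integral>x. f' x b \<partial>lborel)"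
    by (rule integral_dominated_convergence[where s = Q, OF f'm Qm Mi]) (use lim bound in auto)
  then show "(\<integral>x. f' x b \<partial>lborel) = 0" using LIMSEQ_unique Q0 by auto
qed

section \<open>Piecewise quadratic transitions\<close>

text \<open>The piecewise linear function with nodes \<open>0 < p < q\<close> that vanishes outside \<open>[0, q]\<close>, with the height
  \<open>2/q\<close> at \<open>p\<close> that gives it integral 1. The function \<open>step\<close> below is its primitive, a \<open>C\<^sup>1\<close>
  transition from 0 to 1. Both are written with positive parts so as to be differentiated
  without a case distinction.\<close>

definition tent :: "real \<Rightarrow> real \<Rightarrow> real \<Rightarrow> real" where
  "tent p q x = 2 / q * (max 0 x / p - q * max 0 (x - p) / (p * (q - p)) + max 0 (x - q) / (q - p))"

definition step :: "real \<Rightarrow> real \<Rightarrow> real \<Rightarrow> real" where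
  "step p q x = 1 / q * ((max 0 x)\<^sup>2 / p - q * (max 0 (x - p))\<^sup>2 / (p * (q - p)) + (max 0 (x - q))\<^sup>2 / (q - p))"

lemma has_real_derivative_max_0_square:
  "((\<lambda>x. (max 0 x)\<^sup>2) has_real_derivative 2 * max 0 x) (at (x::real))"
proof -
  consider "x < 0" | "x = 0" | "x > 0" by linarith
  then show ?thesis
  proof cases
    case 1
    show ?thesis
      by (rule has_field_derivative_transform_within_open[where S = "{..<0}" and f = "\<lambda>_. 0"])
         (use 1 in \<open>auto intro!: derivative_eq_intros\<close>)
  next
    case 3
    show ?thesis
      by (rule has_field_derivative_transform_within_open[where S = "{0<..}" and f = "\<lambda>x. x\<^sup>2"])
         (use 3 in \<open>auto intro!: derivative_eq_intros\<close>)
  next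
    case 2
    have "((\<lambda>h. (max 0 h)\<^sup>2 / h) \<longlongrightarrow> (0::real)) (at 0)"
    proof (rule Lim_null_comparison)
      show "\<forall>\<^sub>F h in at 0. norm ((max 0 h)\<^sup>2 / h) \<le> \<bar>h::real\<bar>"
        by (intro always_eventually) (auto simp: max_def power2_eq_square)
      show "(abs \<longlongrightarrow> (0::real)) (at 0)" by (intro tendsto_eq_intros) auto
    qed
    then show ?thesis using 2 by (simp add: DERIV_def)
  qed
qed

lemma step_has_derivative: "(step p q has_real_derivative tent p q x) (at x)"
proof -
  have d: "((\<lambda>x. (max 0 (x - c))\<^sup>2) has_real_derivative 2 * max 0 (x - c)) (at x)" for c x :: real
    using DERIV_chain2[OF has_real_derivative_max_0_square, of "\<lambda>x. x - c" 1 x UNIV]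
    by (simp add: DERIV_diff[OF DERIV_ident DERIV_const, simplified])
  have "((\<lambda>x. 1 / q * ((max 0 x)\<^sup>2 / p - q * (max 0 (x - p))\<^sup>2 / (p * (q - p))
        + (max 0 (x - q))\<^sup>2 / (q - p))) has_real_derivative
      1 / q * (2 * max 0 x / p - q * (2 * max 0 (x - p)) / (p * (q - p)) + 2 * max 0 (x - q) / (q - p))) (at x)"
    by (intro DERIV_cmult DERIV_add DERIV_diff DERIV_cdivide has_real_derivative_max_0_square d)
  moreover have "1 / q * (2 * max 0 x / p - q * (2 * max 0 (x - p)) / (p * (q - p)) + 2 * max 0 (x - q) / (q - p))
      = tent p q x"
    by (simp add: tent_def algebra_simps)
  ultimately show ?thesis by (simp only: step_def[abs_def])
qed

lemma continuous_on_tent [continuous_intros]: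
  "continuous_on S f \<Longrightarrow> continuous_on S (\<lambda>x. tent p q (f x))"
  unfolding tent_def divide_inverse by (intro continuous_intros)

lemma continuous_on_step [continuous_intros]:
  "continuous_on S f \<Longrightarrow> continuous_on S (\<lambda>x. step p q (f x))"
  unfolding step_def divide_inverse by (intro continuous_intros)

context
  fixes p q :: real
  assumes pq: "0 < p" "p < q"
begin

lemma tent_outside: "x \<le> 0 \<or> q \<le> x \<Longrightarrow> tent p q x = 0"
  using pq by (auto simp: tent_def max_def field_simps)

lemma tent_left: "0 \<le> x \<Longrightarrow> x \<le> p \<Longrightarrow> tent p q x = 2 * x / (p * q)"
  using pq by (auto simp: tent_def max_def field_simps)

lemma tent_right: "p \<le> x \<Longrightarrow> x \<le> q \<Longrightarrow> tent p q x = 2 * (q - x) / (q * (q - p))"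
  using pq by (auto simp: tent_def max_def divide_simps) (simp_all add: algebra_simps)

lemma step_before: "x \<le> 0 \<Longrightarrow> step p q x = 0"
  using pq by (auto simp: step_def max_def field_simps)

lemma step_left: "0 \<le> x \<Longrightarrow> x \<le> p \<Longrightarrow> step p q x = x\<^sup>2 / (p * q)"
  using pq by (auto simp: step_def max_def field_simps)

lemma step_right: "p \<le> x \<Longrightarrow> x \<le> q \<Longrightarrow> step p q x = 1 - (q - x)\<^sup>2 / (q * (q - p))"
  using pq by (auto simp: step_def max_def divide_simps) (simp_all add: algebra_simps power2_eq_square)

lemma step_after: "q \<le> x \<Longrightarrow> step p q x = 1"
  using pq by (auto simp: step_def max_def divide_simps) (simp_all add: algebra_simps power2_eq_square)

lemma tent_nonneg: "0 \<le> tent p q x"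
proof -
  consider "x \<le> 0 \<or> q \<le> x" | "0 \<le> x" "x \<le> p" | "p \<le> x" "x \<le> q" by linarith
  then show ?thesis using pq by cases (auto simp: tent_outside tent_left tent_right)
qed

lemma tent_le: "tent p q x \<le> 2 / q"
proof -
  consider "x \<le> 0 \<or> q \<le> x" | "0 \<le> x" "x \<le> p" | "p \<le> x" "x \<le> q" by linarith
  then show ?thesis using pq by cases (auto simp: tent_outside tent_left tent_right field_simps)
qed

lemma step_mono: "x \<le> y \<Longrightarrow> step p q x \<le> step p q y"
  by (rule DERIV_nonneg_imp_nondecreasing) (use step_has_derivative tent_nonneg in blast)+

lemma step_nonneg: "0 \<le> step p q x"
  using step_mono[of "min 0 x" x] step_before[of "min 0 x"] by simp

lemma step_le_1: "step p q x \<le> 1"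
  using step_mono[of x "max q x"] step_after[of "max q x"] by simp

text \<open>Two radial profiles that decay as \<open>1 - step p q\<close> away from two circles at distance \<open>q\<close> have sum at
  most 1 wherever both are active. The early node, \<open>p \<le> q/2\<close>, is what makes this true: it makes
  the profile fall faster in the first half than in the second.\<close>

lemma step_add_step_ge_1:
  assumes "2 * p \<le> q" "q \<le> x + y" "0 \<le> x" "0 \<le> y"
  shows "1 \<le> step p q x + step p q y"
proof -
  have *: "1 \<le> step p q x + step p q (q - x)" if x: "0 \<le> x" "x \<le> q / 2" for x
  proof (cases "x \<le> p")
    case True
    have "x\<^sup>2 / (q * (q - p)) \<le> x\<^sup>2 / (p * q)"
      using pq assms by (intro divide_left_mono) (auto simp: algebra_simps mult_mono)
    then show ?thesis using step_left[of x] step_right[of "q - x"] x True assms by simp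
  next
    case False
    have "0 \<le> (x - p) * (q - x - p)" using False x assms by (intro mult_nonneg_nonneg) auto
    then have "(q - x)\<^sup>2 + x\<^sup>2 \<le> q * (q - p) - p * (q - 2 * p)"
      by (simp add: algebra_simps power2_eq_square)
    also have "\<dots> \<le> q * (q - p)" using assms pq by simp
    finally have "((q - x)\<^sup>2 + x\<^sup>2) / (q * (q - p)) \<le> 1" using pq by simp
    then show ?thesis using step_right[of x] step_right[of "q - x"] x False assms pq
      by (simp add: add_divide_distrib)
  qed
  show ?thesis
  proof (cases "x \<le> q / 2")
    case True
    then show ?thesis using *[of x] step_mono[of "q - x" y] assms by linarith
  next
    case False
    show ?thesis
    proof (cases "x \<le> q")
      case True
      then show ?thesis using *[of "q - x"] False step_mono[of "q - x" y] assms by simp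
    next
      case False
      then show ?thesis using step_after[of x] step_nonneg[of y] by simp
    qed
  qed
qed

end

section \<open>Test fields and outward fields on balls\<close>

lemma C1c_fieldE:
  assumes "C1c_field \<phi>"
  obtains D :: "'a::euclidean_space \<Rightarrow> 'a \<Rightarrow>\<^sub>L 'a" and B where
    "\<And>x. (\<phi> has_derivative blinfun_apply (D x)) (at x)" "continuous_on UNIV D"
    "\<And>x. divergence \<phi> x = (\<Sum>b\<in>Basis. D x b \<bullet> b)" "\<And>x. norm x > B \<Longrightarrow> \<phi> x = 0"
proof -
  obtain D :: "'a \<Rightarrow> 'a \<Rightarrow>\<^sub>L 'a" where D: "\<And>x. (\<phi> has_derivative blinfun_apply (D x)) (at x)"
      "continuous_on UNIV D" and c: "compact (closure {x. \<phi> x \<noteq> 0})"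
    using assms unfolding C1c_field_def by blast
  obtain B where "\<And>x. x \<in> closure {x. \<phi> x \<noteq> 0} \<Longrightarrow> norm x \<le> B"
    using compact_imp_bounded[OF c] unfolding bounded_iff by blast
  then have "\<phi> x = 0" if "norm x > B" for x
    using that closure_subset[of "{x. \<phi> x \<noteq> 0}"] by fastforce
  moreover have "divergence \<phi> x = (\<Sum>b\<in>Basis. D x b \<bullet> b)" for x
    unfolding divergence_def using frechet_derivative_at[OF D(1)[of x]] by simp
  ultimately show ?thesis using D that by blast
qed

lemma C1c_fieldI:
  fixes D :: "'a::euclidean_space \<Rightarrow> 'a \<Rightarrow>\<^sub>L 'a"
  assumes "\<And>x. (\<phi> has_derivative blinfun_apply (D x)) (at x)" "continuous_on UNIV D"
    "\<And>x. norm x > B \<Longrightarrow> \<phi> x = 0"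
  shows "C1c_field \<phi>"
proof -
  have "bounded {x. \<phi> x \<noteq> 0}"
    unfolding bounded_iff using assms(3) by (intro exI[of _ B]) force
  then have "compact (closure {x. \<phi> x \<noteq> 0})" by (simp add: compact_closure)
  then show ?thesis using assms unfolding C1c_field_def by blast
qed

lemma C1c_field_diff:
  assumes "C1c_field \<phi>" "C1c_field \<psi>"
  shows "C1c_field (\<lambda>x. \<phi> x - \<psi> x)"
    "divergence (\<lambda>x. \<phi> x - \<psi> x) x = divergence \<phi> x - divergence \<psi> x"
proof -
  from assms(1) obtain D B where D: "\<And>x. (\<phi> has_derivative blinfun_apply (D x)) (at x)" "continuous_on UNIV D"
    "\<And>x. divergence \<phi> x = (\<Sum>b\<in>Basis. D x b \<bullet> b)" "\<And>x. norm x > B \<Longrightarrow> \<phi> x = 0"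
    using C1c_fieldE by blast
  from assms(2) obtain D' B' where D': "\<And>x. (\<psi> has_derivative blinfun_apply (D' x)) (at x)" "continuous_on UNIV D'"
    "\<And>x. divergence \<psi> x = (\<Sum>b\<in>Basis. D' x b \<bullet> b)" "\<And>x. norm x > B' \<Longrightarrow> \<psi> x = 0"
    using C1c_fieldE by blast
  have d: "((\<lambda>x. \<phi> x - \<psi> x) has_derivative blinfun_apply (D x - D' x)) (at x)" for x
    using has_derivative_diff[OF D(1) D'(1)] by (simp add: blinfun.diff_left[abs_def])
  show "C1c_field (\<lambda>x. \<phi> x - \<psi> x)"
    by (rule C1c_fieldI[where D = "\<lambda>x. D x - D' x" and B = "max B B'"])
       (use d D D' in \<open>auto intro: continuous_intros\<close>)
  show "divergence (\<lambda>x. \<phi> x - \<psi> x) x = divergence \<phi> x - divergence \<psi> x"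
    unfolding D(3) D'(3) divergence_def[of "\<lambda>x. \<phi> x - \<psi> x"] frechet_derivative_at[OF d, symmetric]
    by (simp add: blinfun.diff_left inner_diff_left sum_subtractf)
qed

lemma C1c_field_zero: "C1c_field (\<lambda>x. 0)" "divergence (\<lambda>x. 0) x = 0"
proof -
  show "C1c_field (\<lambda>x::'a. 0::'a)"
    by (rule C1c_fieldI[where D = "\<lambda>x. 0" and B = 0]) (auto simp: zero_blinfun.rep_eq)
  show "divergence (\<lambda>x. 0) x = 0" by (simp add: divergence_def)
qed

lemma C1c_field_uminus:
  assumes "C1c_field \<phi>"
  shows "C1c_field (\<lambda>x. - \<phi> x)" "divergence (\<lambda>x. - \<phi> x) x = - divergence \<phi> x"
  using C1c_field_diff[OF C1c_field_zero(1) assms] by (auto simp: C1c_field_zero)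

lemma continuous_on_divergence:
  assumes "C1c_field \<phi>"
  shows "continuous_on UNIV (divergence \<phi>)"
proof -
  from assms obtain D B where D: "\<And>x. (\<phi> has_derivative blinfun_apply (D x)) (at x)" "continuous_on UNIV D"
    "\<And>x. divergence \<phi> x = (\<Sum>b\<in>Basis. D x b \<bullet> b)" "\<And>x. norm x > B \<Longrightarrow> \<phi> x = 0"
    using C1c_fieldE by blast
  show ?thesis unfolding D(3)[abs_def] by (intro continuous_intros D(2))
qed

text \<open>The divergence of \<open>u \<phi>\<close> has integral 0.\<close>

lemma integral_by_parts_C1c_field:
  fixes \<phi> :: "'a::euclidean_space \<Rightarrow> 'a"
  assumes \<phi>: "C1c_field \<phi>"
    and u: "\<And>x. (u has_derivative u' x) (at x)" and u': "\<And>v. continuous_on UNIV (\<lambda>x. u' x v)"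
  shows "integrable lborel (\<lambda>x. u x * divergence \<phi> x + u' x (\<phi> x))"
    "(\<integral>x. u x * divergence \<phi> x + u' x (\<phi> x) \<partial>lborel) = 0"
proof -
  from \<phi> obtain D B where D: "\<And>x. (\<phi> has_derivative blinfun_apply (D x)) (at x)" "continuous_on UNIV D"
    "\<And>x. divergence \<phi> x = (\<Sum>b\<in>Basis. D x b \<bullet> b)" "\<And>x. norm x > B \<Longrightarrow> \<phi> x = 0"
    using C1c_fieldE by blast
  define f' where "f' b x v = u x * (D x v \<bullet> b) + u' x v * (\<phi> x \<bullet> b)" for b x v
  have cont: "continuous_on UNIV u" "continuous_on UNIV \<phi>"
    by (auto intro!: continuous_at_imp_continuous_on has_derivative_continuous[OF u] has_derivative_continuous[OF D(1)])
  have d: "((\<lambda>x. u x * (\<phi> x \<bullet> b)) has_derivative f' b x) (at x)" for b x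
    unfolding f'_def by (rule has_derivative_eq_rhs, rule has_derivative_mult[OF u has_derivative_inner_left[OF D(1)]]) auto
  have c: "continuous_on UNIV (\<lambda>x. f' b x v)" for b v
    unfolding f'_def by (intro continuous_intros u' cont D(2))
  have *: "integrable lborel (\<lambda>x. f' b x b)" "(\<integral>x. f' b x b \<partial>lborel) = 0" for b
    using integral_directional_derivative_0[OF d c, of B b] D(4) by auto
  have e: "u x * divergence \<phi> x + u' x (\<phi> x) = (\<Sum>b\<in>Basis. f' b x b)" for x
  proof -
    have l: "linear (u' x)" using u has_derivative_linear by blast
    have "u' x (\<phi> x) = u' x (\<Sum>b\<in>Basis. (\<phi> x \<bullet> b) *\<^sub>R b)" by (simp add: euclidean_representation)
    also have "\<dots> = (\<Sum>b\<in>Basis. (\<phi> x \<bullet> b) * u' x b)"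
      by (simp add: linear_sum[OF l] linear_cmul[OF l])
    finally show ?thesis by (simp add: f'_def sum.distrib sum_distrib_left D(3) mult.commute)
  qed
  show "integrable lborel (\<lambda>x. u x * divergence \<phi> x + u' x (\<phi> x))"
    unfolding e by (intro Bochner_Integration.integrable_sum *)
  show "(\<integral>x. u x * divergence \<phi> x + u' x (\<phi> x) \<partial>lborel) = 0"
    unfolding e by (subst Bochner_Integration.integral_sum) (auto simp: *)
qed

lemma integrable_divergence:
  assumes "C1c_field \<phi>"
  shows "integrable lborel (divergence \<phi>)"
  using integral_by_parts_C1c_field(1)[OF assms, of "\<lambda>_. 1" "\<lambda>_ _. 0"] by simp

lemma integrable_divergence_lebesgue:
  assumes "C1c_field \<phi>"
  shows "integrable lebesgue (divergence \<phi>)"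
  using integrable_divergence[OF assms] by (simp add: integrable_completion)

lemma set_integrable_divergence:
  assumes "C1c_field \<phi>" "A \<in> sets lebesgue"
  shows "set_integrable lebesgue A (divergence \<phi>)"
  unfolding set_integrable_def
  by (rule integrable_mult_indicator[OF assms(2) integrable_divergence_lebesgue[OF assms(1)]])

text \<open>Replacing the indicator of the ball by radial cutoff functions \<open>u n\<close> and integrating by parts gives
  \<open>- \<integral> \<nabla>(u n) \<bullet> \<phi>\<close>. The gradient points inward and lives in a shell that shrinks to the sphere, and
  so the integrand is nonnegative as soon as the shell is thin enough. Assuming an outward field on
  a whole shell, not only on the sphere, makes this exact and saves an estimate of the
  surface measure.\<close>

lemma integral_divergence_ball_nonneg:
  fixes \<phi> :: "'a::euclidean_space \<Rightarrow> 'a"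
  assumes \<phi>: "C1c_field \<phi>" and \<rho>: "0 \<le> \<rho>\<^sub>0" "\<rho>\<^sub>0 < \<rho>"
    and outward: "\<And>x. \<rho>\<^sub>0 \<le> norm (x - c) \<Longrightarrow> norm (x - c) \<le> \<rho> \<Longrightarrow> 0 \<le> (x - c) \<bullet> \<phi> x"
  shows "0 \<le> (LINT x:ball c \<rho>|lebesgue. divergence \<phi> x)"
proof -
  define z where "z n x = real n * (\<rho>\<^sup>2 - (norm (x - c))\<^sup>2)" for n x
  define u where "u n x = step (1/2) 1 (z n x)" for n x
  define u' where "u' n x v = tent (1/2) 1 (z n x) * (- real n * (2 * ((x - c) \<bullet> v)))" for n x v
  have pq: "(0::real) < 1/2" "(1/2::real) < 1" by auto
  note st = step_before[OF pq] step_after[OF pq] tent_outside[OF pq] tent_nonneg[OF pq] step_nonneg[OF pq] step_le_1[OF pq]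
  have du: "(u n has_derivative u' n x) (at x)" for n x
  proof -
    have "(z n has_derivative (\<lambda>v. - real n * (2 * ((x - c) \<bullet> v)))) (at x)"
      unfolding z_def power2_norm_eq_inner
      by (auto intro!: derivative_eq_intros simp: inner_commute algebra_simps)
    from has_derivative_compose[OF this step_has_derivative[unfolded has_field_derivative_def]]
    show ?thesis unfolding u_def[abs_def] u'_def[abs_def] .
  qed
  have cu': "continuous_on UNIV (\<lambda>x. u' n x v)" for n v
    unfolding u'_def z_def by (intro continuous_intros)
  have cu: "continuous_on UNIV (u n)" for n
    unfolding u_def z_def by (intro continuous_intros)
  note parts = integral_by_parts_C1c_field[OF \<phi> du cu']
  have idiv: "integrable lborel (divergence \<phi>)" by (rule integrable_divergence[OF \<phi>])
  have mdiv: "divergence \<phi> \<in> borel_measurable borel"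
    using continuous_on_divergence[OF \<phi>] by (rule borel_measurable_continuous_onI)
  have um: "u n \<in> borel_measurable borel" for n using cu by (rule borel_measurable_continuous_onI)
  have imdiv: "(\<lambda>x. indicat_real (ball c \<rho>) x * divergence \<phi> x) \<in> borel_measurable borel"
    using mdiv by (intro borel_measurable_times borel_measurable_indicator) auto
  have bound: "norm (u n x * divergence \<phi> x) \<le> norm (divergence \<phi> x)" for n x
    using st unfolding u_def by (simp add: abs_mult mult_left_le_one_le)
  have ui: "integrable lborel (\<lambda>x. u n x * divergence \<phi> x)" for n
    by (rule Bochner_Integration.integrable_bound[OF idiv]) (use um mdiv bound in auto)
  have nonneg: "0 \<le> (\<integral>x. u n x * divergence \<phi> x \<partial>lborel)" if n: "1 \<le> real n * (\<rho>\<^sup>2 - \<rho>\<^sub>0\<^sup>2)" for n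
  proof -
    \<comment> \<open>Outside the shell \<open>0 < z n x < 1\<close> the cutoff is locally constant; on it \<open>norm (x - c)\<close>
      lies between \<open>\<rho>\<^sub>0\<close> and \<open>\<rho>\<close>.\<close>
    have "u' n x (\<phi> x) \<le> 0" for x
    proof (cases "z n x \<le> 0 \<or> 1 \<le> z n x")
      case True
      then show ?thesis by (simp add: u'_def st)
    next
      case False
      then have n0: "0 < real n" using n by (cases "n = 0") auto
      have "real n * (\<rho>\<^sup>2 - (norm (x - c))\<^sup>2) \<le> real n * (\<rho>\<^sup>2 - \<rho>\<^sub>0\<^sup>2)" "0 \<le> real n * (\<rho>\<^sup>2 - (norm (x - c))\<^sup>2)"
        using False n by (auto simp: z_def)
      then have "\<rho>\<^sub>0\<^sup>2 \<le> (norm (x - c))\<^sup>2" "(norm (x - c))\<^sup>2 \<le> \<rho>\<^sup>2"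
        using n0 by (auto simp: zero_le_mult_iff)
      then have "\<rho>\<^sub>0 \<le> norm (x - c)" "norm (x - c) \<le> \<rho>"
        using \<rho> by (auto intro: power2_le_imp_le)
      then have "0 \<le> tent (1/2) 1 (z n x) * (real n * (2 * ((x - c) \<bullet> \<phi> x)))"
        using outward[of x] st by (intro mult_nonneg_nonneg) auto
      then show ?thesis by (simp add: u'_def)
    qed
    moreover have "integrable lborel (\<lambda>x. u' n x (\<phi> x))"
      using Bochner_Integration.integrable_diff[OF parts(1)[of n] ui[of n]] by simp
    moreover have "(\<integral>x. u n x * divergence \<phi> x \<partial>lborel) + (\<integral>x. u' n x (\<phi> x) \<partial>lborel) = 0"
      using parts(2)[of n] calculation(2) ui[of n] by simp
    moreover have "(\<integral>x. u' n x (\<phi> x) \<partial>lborel) \<le> 0"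
      using Bochner_Integration.integral_nonneg[of lborel "\<lambda>x. - u' n x (\<phi> x)"] calculation(1) by simp
    ultimately show ?thesis by linarith
  qed
  have lim: "(\<lambda>n. u n x * divergence \<phi> x) \<longlonglongrightarrow> indicator (ball c \<rho>) x * divergence \<phi> x" for x
  proof (cases "norm (x - c) < \<rho>")
    case True
    then have "0 < \<rho>\<^sup>2 - (norm (x - c))\<^sup>2" by (simp add: power_strict_mono)
    then obtain N where N: "1 < real N * (\<rho>\<^sup>2 - (norm (x - c))\<^sup>2)"
      using ex_less_of_nat_mult by blast
    have "u n x = 1" if "n \<ge> N" for n
    proof -
      have "real N * (\<rho>\<^sup>2 - (norm (x - c))\<^sup>2) \<le> z n x"
        unfolding z_def using that \<open>0 < \<rho>\<^sup>2 - (norm (x - c))\<^sup>2\<close> by (intro mult_right_mono) auto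
      then show ?thesis using N by (simp add: u_def st)
    qed
    then show ?thesis using True
      by (intro tendsto_eventually eventually_sequentiallyI[of N]) (simp add: dist_norm norm_minus_commute)
  next
    case False
    then have "\<rho>\<^sup>2 \<le> (norm (x - c))\<^sup>2" using \<rho> by (intro power_mono) auto
    then have "z n x \<le> 0" for n unfolding z_def by (simp add: mult_nonneg_nonpos)
    then show ?thesis using False by (simp add: u_def st dist_norm norm_minus_commute)
  qed
  have limI: "(\<lambda>n. \<integral>x. u n x * divergence \<phi> x \<partial>lborel)
      \<longlonglongrightarrow> (\<integral>x. indicator (ball c \<rho>) x * divergence \<phi> x \<partial>lborel)"
    by (rule integral_dominated_convergence[where w = "\<lambda>x. norm (divergence \<phi> x)"])
       (use idiv mdiv imdiv um lim bound in auto)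
  have "0 < \<rho>\<^sup>2 - \<rho>\<^sub>0\<^sup>2" using \<rho> by (simp add: power_strict_mono)
  then obtain N where N: "1 < real N * (\<rho>\<^sup>2 - \<rho>\<^sub>0\<^sup>2)"
    using ex_less_of_nat_mult by blast
  have "1 \<le> real n * (\<rho>\<^sup>2 - \<rho>\<^sub>0\<^sup>2)" if "n \<ge> N" for n
  proof -
    have "real N * (\<rho>\<^sup>2 - \<rho>\<^sub>0\<^sup>2) \<le> real n * (\<rho>\<^sup>2 - \<rho>\<^sub>0\<^sup>2)"
      using that \<open>0 < \<rho>\<^sup>2 - \<rho>\<^sub>0\<^sup>2\<close> by (intro mult_right_mono) auto
    then show ?thesis using N by linarith
  qed
  then have "0 \<le> (\<integral>x. indicator (ball c \<rho>) x * divergence \<phi> x \<partial>lborel)"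
    using nonneg by (intro LIMSEQ_le_const[OF limI]) blast
  also have "\<dots> = (LINT x:ball c \<rho>|lebesgue. divergence \<phi> x)"
    unfolding set_lebesgue_integral_def real_scaleR_def
    by (rule integral_completion[symmetric]) (use imdiv in simp)
  finally show ?thesis .
qed

section \<open>Radial fields\<close>

text \<open>In terms of the squared norm the field is smooth at the centre, where the norm is not.\<close>

lemma C1c_field_square_radial:
  fixes c :: "'a::euclidean_space" and q q' :: "real \<Rightarrow> real"
  assumes q: "\<And>s. (q has_real_derivative q' s) (at s)" and q': "continuous_on UNIV q'"
    and supp: "\<And>s. s > B \<Longrightarrow> q s = 0"
  defines "V \<equiv> \<lambda>x. q ((norm (x - c))\<^sup>2) *\<^sub>R (x - c)"
  shows "C1c_field V"
    "divergence V x = real DIM('a) * q ((norm (x - c))\<^sup>2) + 2 * (norm (x - c))\<^sup>2 * q' ((norm (x - c))\<^sup>2)"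
proof -
  define D where "D x = q ((norm (x - c))\<^sup>2) *\<^sub>R (id_blinfun :: 'a \<Rightarrow>\<^sub>L 'a)
      + (2 * q' ((norm (x - c))\<^sup>2)) *\<^sub>R (blinfun_scaleR_left (x - c) o\<^sub>L blinfun_inner_left (x - c))" for x
  have contq: "continuous_on UNIV q"
    using q by (meson DERIV_continuous continuous_at_imp_continuous_on)
  have D_apply: "D x v = q ((norm (x - c))\<^sup>2) *\<^sub>R v + (2 * q' ((norm (x - c))\<^sup>2) * ((x - c) \<bullet> v)) *\<^sub>R (x - c)" for x v
    by (simp add: D_def blinfun.add_left blinfun.scaleR_left inner_commute)
  have d: "(V has_derivative D x) (at x)" for x
  proof -
    have "((\<lambda>x. (norm (x - c))\<^sup>2) has_derivative (\<lambda>v. 2 * ((x - c) \<bullet> v))) (at x)"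
      unfolding power2_norm_eq_inner
      by (auto intro!: derivative_eq_intros simp: inner_commute algebra_simps)
    from has_derivative_compose[OF this q[unfolded has_field_derivative_def]]
    have "((\<lambda>x. q ((norm (x - c))\<^sup>2)) has_derivative (\<lambda>v. q' ((norm (x - c))\<^sup>2) * (2 * ((x - c) \<bullet> v)))) (at x)" .
    then have "((\<lambda>x. q ((norm (x - c))\<^sup>2) *\<^sub>R (x - c)) has_derivative (\<lambda>v. q ((norm (x - c))\<^sup>2) *\<^sub>R (v - 0)
        + (q' ((norm (x - c))\<^sup>2) * (2 * ((x - c) \<bullet> v))) *\<^sub>R (x - c))) (at x)"
      by (rule has_derivative_scaleR[OF _ has_derivative_diff[OF has_derivative_ident has_derivative_const]])
    then have "(V has_derivative (\<lambda>v. q ((norm (x - c))\<^sup>2) *\<^sub>R (v - 0)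
        + (q' ((norm (x - c))\<^sup>2) * (2 * ((x - c) \<bullet> v))) *\<^sub>R (x - c))) (at x)"
      by (simp only: V_def)
    then show ?thesis
      by (rule has_derivative_eq_rhs) (simp add: fun_eq_iff D_apply mult_ac inner_commute)
  qed
  show "C1c_field V"
  proof (rule C1c_fieldI[OF d])
    have "continuous_on UNIV (\<lambda>x. q ((norm (x - c))\<^sup>2))" "continuous_on UNIV (\<lambda>x. q' ((norm (x - c))\<^sup>2))"
      by (intro continuous_on_compose2[OF contq] continuous_on_compose2[OF q'] continuous_intros; simp)+
    then show "continuous_on UNIV D"
      unfolding D_def
      by (intro continuous_intros bounded_linear.continuous_on[OF bounded_linear_blinfun_scaleR_left]
          bounded_linear.continuous_on[OF bounded_linear_blinfun_inner_left])
    show "V x = 0" if "norm x > norm c + (1 + \<bar>B\<bar>)" for x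
    proof -
      have "1 + \<bar>B\<bar> < norm (x - c)" using that norm_triangle_ineq2[of x c] by linarith
      moreover have "\<bar>B\<bar> < (1 + \<bar>B\<bar>)\<^sup>2" by (simp add: power2_eq_square algebra_simps add_pos_nonneg)
      ultimately have "B < (norm (x - c))\<^sup>2"
        using power_strict_mono[of "1 + \<bar>B\<bar>" "norm (x - c)" 2] by simp
      then show ?thesis by (simp add: V_def supp)
    qed
  qed
  have "divergence V x = (\<Sum>b\<in>Basis. D x b \<bullet> b)"
    unfolding divergence_def using frechet_derivative_at[OF d[of x]] by simp
  also have "\<dots> = (\<Sum>b\<in>Basis. q ((norm (x - c))\<^sup>2) + 2 * q' ((norm (x - c))\<^sup>2) * (((x - c) \<bullet> b) * ((x - c) \<bullet> b)))"
    by (intro sum.cong) (auto simp: D_apply inner_add_left)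
  also have "\<dots> = real DIM('a) * q ((norm (x - c))\<^sup>2) + 2 * q' ((norm (x - c))\<^sup>2) * ((x - c) \<bullet> (x - c))"
    unfolding euclidean_inner[of "x - c" "x - c"] by (simp add: sum.distrib sum_distrib_left)
  finally show "divergence V x = real DIM('a) * q ((norm (x - c))\<^sup>2) + 2 * (norm (x - c))\<^sup>2 * q' ((norm (x - c))\<^sup>2)"
    by (simp add: power2_norm_eq_inner)
qed

definition radial :: "(real \<Rightarrow> real) \<Rightarrow> 'a::euclidean_space \<Rightarrow> 'a \<Rightarrow> 'a" where
  "radial F c x = (F (norm (x - c)) / norm (x - c)) *\<^sub>R (x - c)"

text \<open>The divergence consists of the radial derivative of the profile and of the mean curvature
  \<open>(n - 1)/\<rho>\<close> of the spheres, weighted by the profile.\<close>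

lemma C1c_field_radial:
  fixes c :: "'a::euclidean_space" and F F' :: "real \<Rightarrow> real"
  assumes F: "\<And>s. (F has_real_derivative F' s) (at s)" and F': "continuous_on UNIV F'"
    and \<rho>\<^sub>0: "0 < \<rho>\<^sub>0" and inner: "\<And>s. s \<le> \<rho>\<^sub>0 \<Longrightarrow> F s = 0" and outer: "\<And>s. s > B \<Longrightarrow> F s = 0"
  shows "C1c_field (radial F c)"
    "divergence (radial F c) x = F' (norm (x - c)) + (real DIM('a) - 1) * (F (norm (x - c)) / norm (x - c))"
proof -
  define q where "q s = F (sqrt s) / sqrt s" for s
  define q' where "q' s = (F' (sqrt s) - F (sqrt s) / sqrt s) / (2 * s)" for s
  have F'0: "F' s = 0" if "s < \<rho>\<^sub>0" for s
  proof -
    have "(F has_real_derivative 0) (at s)"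
      by (rule has_field_derivative_transform_within_open[where S = "{..<\<rho>\<^sub>0}" and f = "\<lambda>_. 0"])
         (use that inner in auto)
    then show ?thesis using F DERIV_unique by blast
  qed
  have small: "q s = 0" "q' s = 0" if "s < \<rho>\<^sub>0\<^sup>2" for s
  proof -
    have "sqrt s < \<rho>\<^sub>0" using that \<rho>\<^sub>0 by (metis less_eq_real_def real_sqrt_less_iff real_sqrt_unique)
    then show "q s = 0" "q' s = 0" using inner F'0 by (auto simp: q_def q'_def)
  qed
  have dq: "(q has_real_derivative q' s) (at s)" for s
  proof (cases "s < \<rho>\<^sub>0\<^sup>2")
    case True
    have "(q has_real_derivative 0) (at s)"
      by (rule has_field_derivative_transform_within_open[where S = "{..<\<rho>\<^sub>0\<^sup>2}" and f = "\<lambda>_. 0"])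
         (use True small in auto)
    then show ?thesis using small True by simp
  next
    case False
    then have s: "s > 0" using \<rho>\<^sub>0 by (meson less_le_trans not_less zero_less_power)
    have dF: "((\<lambda>s. F (sqrt s)) has_real_derivative F' (sqrt s) * (inverse (sqrt s) / 2)) (at s)"
      by (rule DERIV_chain2[OF F DERIV_real_sqrt[OF s]])
    have "(q has_real_derivative (F' (sqrt s) * (inverse (sqrt s) / 2) * sqrt s - F (sqrt s) * (inverse (sqrt s) / 2))
        / (sqrt s * sqrt s)) (at s)"
      unfolding q_def[abs_def] using s by (intro DERIV_divide dF DERIV_real_sqrt) auto
    moreover have "(F' (sqrt s) * (inverse (sqrt s) / 2) * sqrt s - F (sqrt s) * (inverse (sqrt s) / 2))
        / (sqrt s * sqrt s) = q' s"
      using s by (simp add: q'_def field_simps)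
    ultimately show ?thesis by simp
  qed
  have cF: "continuous_on UNIV F" using F by (meson DERIV_continuous continuous_at_imp_continuous_on)
  have cq': "continuous_on UNIV q'"
  proof -
    have "continuous_on {0<..} q'"
      unfolding q'_def
      by (intro continuous_intros continuous_on_compose2[OF cF] continuous_on_compose2[OF F']) auto
    moreover have "continuous_on {..<\<rho>\<^sub>0\<^sup>2} q'"
      using small by (intro continuous_on_eq[OF continuous_on_const[of _ 0]]) auto
    ultimately have "continuous_on ({0<..} \<union> {..<\<rho>\<^sub>0\<^sup>2}) q'"
      by (intro continuous_on_open_Un) auto
    moreover have "{0<..} \<union> {..<\<rho>\<^sub>0\<^sup>2} = UNIV" using \<rho>\<^sub>0 by (auto simp: not_less intro: le_less_trans)
    ultimately show ?thesis by simp
  qed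
  have q0: "q s = 0" if "s > B\<^sup>2" for s
  proof -
    have "B < sqrt s" using that real_less_rsqrt by blast
    then show ?thesis using outer by (simp add: q_def)
  qed
  have V: "radial F c = (\<lambda>x. q ((norm (x - c))\<^sup>2) *\<^sub>R (x - c))"
    by (simp add: fun_eq_iff radial_def q_def)
  show "C1c_field (radial F c)"
    unfolding V by (rule C1c_field_square_radial(1)[OF dq cq' q0])
  have "divergence (radial F c) x
      = real DIM('a) * q ((norm (x - c))\<^sup>2) + 2 * (norm (x - c))\<^sup>2 * q' ((norm (x - c))\<^sup>2)"
    unfolding V by (rule C1c_field_square_radial(2)[OF dq cq' q0])
  also have "\<dots> = F' (norm (x - c)) + (real DIM('a) - 1) * (F (norm (x - c)) / norm (x - c))"
  proof (cases "x = c")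
    case True
    then show ?thesis using F'0[of 0] \<rho>\<^sub>0 by (simp add: q_def)
  next
    case False
    then show ?thesis by (simp add: q_def q'_def field_simps)
  qed
  finally show "divergence (radial F c) x
      = F' (norm (x - c)) + (real DIM('a) - 1) * (F (norm (x - c)) / norm (x - c))" .
qed

section \<open>Calibrations\<close>

text \<open>By duality the field bounds every perimeter from below, and by \<open>calib\<close> the perimeter of \<open>\<Omega>\<close> also from
  above. Exchanging \<open>\<Omega>\<close> for \<open>S\<close> changes the integral of the divergence by at most \<open>\<theta>\<close> times the measure
  of the symmetric difference, while the energy charges \<open>lam > \<theta>\<close> times that measure.\<close>

lemma calibrated_set_is_strict_minimizer:
  fixes \<Omega> :: "'a::euclidean_space set"
  assumes \<phi>: "C1c_field \<phi>" "\<And>x. norm (\<phi> x) \<le> 1" "\<And>x. \<bar>divergence \<phi> x\<bar> \<le> \<theta>" "\<theta> < lam"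
    and \<Omega>: "\<Omega> \<in> sets lebesgue"
    and calib: "\<And>\<psi>. C1c_field \<psi> \<Longrightarrow> (\<And>x. norm (\<psi> x) \<le> 1) \<Longrightarrow>
        (LINT x:\<Omega>|lebesgue. divergence \<psi> x) \<le> (LINT x:\<Omega>|lebesgue. divergence \<phi> x)"
    and S: "S \<in> sets lebesgue" "emeasure lebesgue (sym_diff S \<Omega>) > 0"
  shows "L1TV_energy \<Omega> lam \<Omega> < L1TV_energy \<Omega> lam S"
proof -
  define P where "P = (LINT x:\<Omega>|lebesgue. divergence \<phi> x)"
  have P0: "0 \<le> P"
    using calib[OF C1c_field_zero(1)] by (simp add: P_def C1c_field_zero)
  have lam: "0 < lam" using \<phi>(3)[of 0] \<phi>(4) by linarith
  have "perimeter \<Omega> \<le> ennreal P"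
    unfolding perimeter_def P_def by (intro SUP_least ennreal_leI) (use calib in auto)
  then have E\<Omega>: "L1TV_energy \<Omega> lam \<Omega> \<le> ennreal P" by (simp add: L1TV_energy_def)
  define J where "J = (LINT x:S|lebesgue. divergence \<phi> x)"
  have "ennreal J \<le> perimeter S"
    unfolding perimeter_def J_def using \<phi> by (intro SUP_upper) auto
  then have ES: "ennreal J + ennreal lam * emeasure lebesgue (sym_diff S \<Omega>) \<le> L1TV_energy \<Omega> lam S"
    unfolding L1TV_energy_def by (rule add_right_mono)
  have \<Delta>: "sym_diff S \<Omega> \<in> sets lebesgue" using S \<Omega> by auto
  show ?thesis
  proof (cases "emeasure lebesgue (sym_diff S \<Omega>) = \<infinity>")
    case True
    then have "L1TV_energy \<Omega> lam S = \<infinity>" using lam by (simp add: L1TV_energy_def ennreal_mult_top)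
    moreover have "ennreal P < \<infinity>" by simp
    ultimately show ?thesis using E\<Omega> by (metis le_less_trans)
  next
    case False
    define m where "m = measure lebesgue (sym_diff S \<Omega>)"
    have em: "emeasure lebesgue (sym_diff S \<Omega>) = ennreal m"
      unfolding m_def using False by (simp add: emeasure_eq_ennreal_measure)
    then have m: "0 < m" using S(2) by simp
    note i = set_integrable_divergence[OF \<phi>(1)]
    have im: "integrable lebesgue (\<lambda>x. - \<theta> * indicator (sym_diff S \<Omega>) x)"
      using False \<Delta> by (intro integrable_mult_right integrable_real_indicator) (auto simp: top.not_eq_extremum)
    have "- \<theta> * m = (\<integral>x. - \<theta> * indicator (sym_diff S \<Omega>) x \<partial>lebesgue)"
      using \<Delta> False by (simp add: m_def)
    also have "\<dots> \<le> (\<integral>x. indicator S x *\<^sub>R divergence \<phi> x - indicator \<Omega> x *\<^sub>R divergence \<phi> x \<partial>lebesgue)"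
    proof (rule integral_mono[OF im])
      show "integrable lebesgue (\<lambda>x. indicator S x *\<^sub>R divergence \<phi> x - indicator \<Omega> x *\<^sub>R divergence \<phi> x)"
        using i[OF S(1)] i[OF \<Omega>] unfolding set_integrable_def by (rule Bochner_Integration.integrable_diff)
      show "- \<theta> * indicator (sym_diff S \<Omega>) x \<le> indicator S x *\<^sub>R divergence \<phi> x - indicator \<Omega> x *\<^sub>R divergence \<phi> x" for x
        using \<phi>(3)[of x] by (auto simp: indicator_def abs_le_iff)
    qed
    also have "\<dots> = J - P"
      using i[OF S(1)] i[OF \<Omega>] unfolding J_def P_def set_lebesgue_integral_def set_integrable_def
      by (rule Bochner_Integration.integral_diff)
    finally have "P < J + lam * m"
      using mult_strict_right_mono[OF \<phi>(4) m] by linarith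
    then have "ennreal P < ennreal (J + lam * m)" using P0 by (simp add: ennreal_less_iff)
    also have "\<dots> \<le> ennreal J + ennreal (lam * m)"
    proof (cases "0 \<le> J")
      case True
      then show ?thesis using lam m by (simp add: ennreal_plus)
    next
      case False
      then have "ennreal (J + lam * m) \<le> ennreal (lam * m)" by (intro ennreal_leI) simp
      then show ?thesis by (simp add: add_increasing)
    qed
    also have "\<dots> \<le> L1TV_energy \<Omega> lam S"
      using ES lam m by (simp add: em ennreal_mult)
    finally show ?thesis using E\<Omega> by (rule le_less_trans[rotated])
  qed
qed

section \<open>Radial plateau profiles\<close>

text \<open>The radial profile of each of the three fields: it rises over \<open>[s, s + 6]\<close>, equals 1 up to the
  radius \<open>r\<close> of the boundary circle, and falls over \<open>[r, r + q]\<close>. Being flat on one side of the circle it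
  makes the field equal to the unit normal on a whole shell. Vanishing near 0 it makes the
  radial field smooth at its centre.\<close>

definition plateau :: "real \<Rightarrow> real \<Rightarrow> real \<Rightarrow> real \<Rightarrow> real \<Rightarrow> real" where
  "plateau s r p q \<rho> = step 3 6 (\<rho> - s) - step p q (\<rho> - r)"

definition plateau' :: "real \<Rightarrow> real \<Rightarrow> real \<Rightarrow> real \<Rightarrow> real \<Rightarrow> real" where
  "plateau' s r p q \<rho> = tent 3 6 (\<rho> - s) - tent p q (\<rho> - r)"

context
  fixes s r p q :: real
  assumes s: "0 < s" "s + 6 \<le> r" and pq: "0 < p" "p < q"
begin

lemma plateau_has_derivative: "(plateau s r p q has_real_derivative plateau' s r p q \<rho>) (at \<rho>)"
proof -
  have "((\<lambda>x. step p q (x - c)) has_real_derivative tent p q (\<rho> - c)) (at \<rho>)" for p q c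
    using DERIV_chain2[OF step_has_derivative, of "\<lambda>x. x - c" 1 \<rho> UNIV]
    by (simp add: DERIV_diff[OF DERIV_ident DERIV_const, simplified])
  then show ?thesis unfolding plateau_def[abs_def] plateau'_def by (intro DERIV_diff)
qed

lemma plateau_low: "\<rho> \<le> s \<Longrightarrow> plateau s r p q \<rho> = 0" "\<rho> \<le> s \<Longrightarrow> plateau' s r p q \<rho> = 0"
  using s pq by (simp_all add: plateau_def plateau'_def step_before tent_outside)

lemma plateau_high: "r + q \<le> \<rho> \<Longrightarrow> plateau s r p q \<rho> = 0" "r + q \<le> \<rho> \<Longrightarrow> plateau' s r p q \<rho> = 0"
  using s pq by (simp_all add: plateau_def plateau'_def step_after tent_outside)

lemma plateau_flat: "s + 6 \<le> \<rho> \<Longrightarrow> \<rho> \<le> r \<Longrightarrow> plateau s r p q \<rho> = 1"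
  using s pq by (simp add: plateau_def step_before step_after)

lemma plateau_rise:
  assumes "\<rho> \<le> r"
  shows "plateau s r p q \<rho> = step 3 6 (\<rho> - s)" "plateau' s r p q \<rho> = tent 3 6 (\<rho> - s)"
  using assms s pq by (simp_all add: plateau_def plateau'_def step_before tent_outside)

lemma plateau_fall:
  assumes "r \<le> \<rho>"
  shows "plateau s r p q \<rho> = 1 - step p q (\<rho> - r)" "plateau' s r p q \<rho> = - tent p q (\<rho> - r)"
  using assms s pq by (simp_all add: plateau_def plateau'_def step_after tent_outside)

lemma plateau_bounds: "0 \<le> plateau s r p q \<rho>" "plateau s r p q \<rho> \<le> 1"
proof -
  have "0 \<le> plateau s r p q \<rho> \<and> plateau s r p q \<rho> \<le> 1"
  proof (cases "\<rho> \<le> r")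
    case True
    then show ?thesis by (simp add: plateau_rise step_nonneg step_le_1)
  next
    case False
    then show ?thesis using pq by (simp add: plateau_fall step_nonneg step_le_1)
  qed
  then show "0 \<le> plateau s r p q \<rho>" "plateau s r p q \<rho> \<le> 1" by auto
qed

lemma plateau_div_bounds: "0 \<le> plateau s r p q \<rho> / \<rho>" "plateau s r p q \<rho> / \<rho> \<le> 1 / s"
proof -
  have "0 \<le> plateau s r p q \<rho> / \<rho> \<and> plateau s r p q \<rho> / \<rho> \<le> 1 / s"
  proof (cases "\<rho> \<le> s")
    case True
    then show ?thesis using s by (simp add: plateau_low)
  next
    case False
    then show ?thesis using s plateau_bounds[of \<rho>] by (auto intro: frac_le)
  qed
  then show "0 \<le> plateau s r p q \<rho> / \<rho>" "plateau s r p q \<rho> / \<rho> \<le> 1 / s" by auto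
qed

text \<open>The divergence of the planar radial field inside its circle; the rise is slow (slope at most
  1/3) and starts far enough from the centre for both terms to be small.\<close>

lemma plateau_radial_flux_rise:
  assumes "\<rho> \<le> r"
  shows "0 \<le> plateau' s r p q \<rho> + plateau s r p q \<rho> / \<rho>"
    "plateau' s r p q \<rho> + plateau s r p q \<rho> / \<rho> \<le> 1 / 3 + 1 / s"
  using plateau_div_bounds[of \<rho>] tent_nonneg[of 3 6 "\<rho> - s"] tent_le[of 3 6 "\<rho> - s"]
  by (simp_all add: plateau_rise[OF assms])

lemma C1c_field_radial_plateau:
  fixes c :: "real \<times> real"
  shows "C1c_field (radial (plateau s r p q) c)"
    "divergence (radial (plateau s r p q) c) x
      = plateau' s r p q (norm (x - c)) + plateau s r p q (norm (x - c)) / norm (x - c)"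
proof -
  have c': "continuous_on UNIV (plateau' s r p q)" unfolding plateau'_def by (intro continuous_intros)
  note C = C1c_field_radial[where \<rho>\<^sub>0 = s and B = "r + q", OF
      plateau_has_derivative c' s(1) plateau_low(1) plateau_high(1)[OF less_imp_le]]
  show "C1c_field (radial (plateau s r p q) c)" by (rule C)
  show "divergence (radial (plateau s r p q) c) x
      = plateau' s r p q (norm (x - c)) + plateau s r p q (norm (x - c)) / norm (x - c)"
    using C(2)[of c x] by simp
qed

end

lemma norm_radial: "norm (radial F c x) \<le> \<bar>F (norm (x - c))\<bar>"
  by (simp add: radial_def)

section \<open>A calibrated disc with two holes\<close>

text \<open>The divergence of one hole field at distance \<open>t\<close> from its hole, with the curvature
  bounded below by 1/14 (as \<open>r + w < 14\<close>). The function is concave beyond \<open>p = 1/50\<close>, and the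
  bound is close to its tangent at the middle of the neck. It is linear so that it can be added for the two
  holes: their distances to a point sum to at least \<open>w = 99/50\<close>, and at equality the two bounds sum
  to \<open>2 * 4847/5000 - 12/25 * 99/50 = 0.9884\<close>, below 1. Without the curvature term the sum
  over the two holes would have the average \<open>2/w > 1\<close> along the axis.\<close>

lemma neck_bound:
  fixes t :: real
  assumes "0 \<le> t" "t \<le> 99/50"
  shows "tent (1/50) (99/50) t - (1 - step (1/50) (99/50) t) / 14 \<le> 4847/5000 - 12/25 * t"
proof (cases "t \<le> 1/50")
  case True
  have "t\<^sup>2 \<le> (1/50)\<^sup>2" using True assms by (intro power_mono) auto
  then have "step (1/50) (99/50) t \<le> 1/99"
    using True assms by (simp add: step_left power2_eq_square)
  moreover have "tent (1/50) (99/50) t \<le> 100/99" using tent_le[of "1/50" "99/50" t] by simp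
  moreover have "P \<le> 1/99 \<Longrightarrow> T \<le> 100/99 \<Longrightarrow> T - (1 - P) / 14 \<le> 4847/5000 - 12/25 * t" for P T
    using True by (simp add: field_simps)
  ultimately show ?thesis by blast
next
  case False
  define u where "u = 99/50 - t"
  have st: "tent (1/50) (99/50) t = 2 * u / (99/50 * (98/50))" "step (1/50) (99/50) t = 1 - u\<^sup>2 / (99/50 * (98/50))"
    using False assms tent_right[of "1/50" "99/50" t] step_right[of "1/50" "99/50" t]
    by (simp_all add: u_def)
  \<comment> \<open>Tangency at the middle of the neck.\<close>
  have "0 \<le> (u - 99/100)\<^sup>2" by simp
  then have "u * (99/50) - 9801/10000 \<le> u\<^sup>2" by (simp add: power2_eq_square algebra_simps)
  then have "2 * u / (99/50 * (98/50)) - (u\<^sup>2 / (99/50 * (98/50))) / 14 \<le> 4847/5000 - 12/25 * (99/50 - u)"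
    using assms by (simp add: u_def field_simps)
  then show ?thesis by (simp add: st u_def)
qed

abbreviation "hole \<equiv> plateau 4 (1201/100) (1/50) (99/50)"
abbreviation "hole' \<equiv> plateau' 4 (1201/100) (1/50) (99/50)"
abbreviation "rim \<equiv> plateau 28 40 3 6"
abbreviation "rim' \<equiv> plateau' 28 40 3 6"

definition left_centre :: "real \<times> real" where "left_centre = (-13, 0)"
definition right_centre :: "real \<times> real" where "right_centre = (13, 0)"

text \<open>The outer normal of the set points outward on the rim but into the holes, hence the signs.\<close>

definition calibration :: "real \<times> real \<Rightarrow> real \<times> real" where
  "calibration x = radial rim 0 x - radial hole left_centre x - radial hole right_centre x"

definition pierced_disc :: "(real \<times> real) set" where
  "pierced_disc = ball 0 40 - ball left_centre (1201/100) - ball right_centre (1201/100)"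

lemma center_distances:
  "26 \<le> norm (x - left_centre) + norm (x - right_centre)"
  "norm x \<le> norm (x - left_centre) + 13" "norm x \<le> norm (x - right_centre) + 13"
  "norm (x - left_centre) \<le> norm x + 13" "norm (x - right_centre) \<le> norm x + 13"
proof -
  have n: "norm left_centre = 13" "norm right_centre = 13" "norm (right_centre - left_centre) = 26"
    by (simp_all add: left_centre_def right_centre_def norm_Pair)
  show "26 \<le> norm (x - left_centre) + norm (x - right_centre)"
    using norm_triangle_ineq4[of "x - left_centre" "x - right_centre"] n by simp
  show "norm x \<le> norm (x - left_centre) + 13" "norm x \<le> norm (x - right_centre) + 13"
    using norm_triangle_ineq2[of x left_centre] norm_triangle_ineq2[of x right_centre] n by auto
  show "norm (x - left_centre) \<le> norm x + 13" "norm (x - right_centre) \<le> norm x + 13"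
    using norm_triangle_ineq4[of x left_centre] norm_triangle_ineq4[of x right_centre] n by auto
qed

text \<open>The divergence of a hole field, up to sign, in the hole, in the neck region and beyond it. The
  second bound is \<open>neck_bound\<close> rewritten for \<open>\<rho> = 12.01 + t\<close>.\<close>

lemma hole_flux:
  shows "\<rho> \<le> 1201/100 \<Longrightarrow> 0 \<le> hole' \<rho> + hole \<rho> / \<rho> \<and> hole' \<rho> + hole \<rho> / \<rho> \<le> 7/12"
    and "1201/100 \<le> \<rho> \<Longrightarrow> \<rho> \<le> 1399/100 \<Longrightarrow>
      - (hole' \<rho> + hole \<rho> / \<rho>) \<le> 33671/5000 - 12/25 * \<rho>"
    and "1201/100 \<le> \<rho> \<Longrightarrow> hole' \<rho> + hole \<rho> / \<rho> \<le> 1/12"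
    and "1399/100 \<le> \<rho> \<Longrightarrow> hole' \<rho> + hole \<rho> / \<rho> = 0"
proof -
  show "0 \<le> hole' \<rho> + hole \<rho> / \<rho> \<and> hole' \<rho> + hole \<rho> / \<rho> \<le> 7/12" if "\<rho> \<le> 1201/100"
    using plateau_radial_flux_rise[of 4 "1201/100" "1/50" "99/50" \<rho>] that by simp
  show "hole' \<rho> + hole \<rho> / \<rho> = 0" if "1399/100 \<le> \<rho>"
    using that by (simp add: plateau_high)
  show "hole' \<rho> + hole \<rho> / \<rho> \<le> 1/12" if "1201/100 \<le> \<rho>"
  proof -
    have "hole \<rho> / \<rho> \<le> 1 / 12"
      using that plateau_bounds[of 4 "1201/100" "1/50" "99/50" \<rho>] by (intro frac_le) auto
    moreover have "hole' \<rho> \<le> 0" using that by (simp add: plateau_fall tent_nonneg)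
    ultimately show ?thesis by linarith
  qed
  show "- (hole' \<rho> + hole \<rho> / \<rho>) \<le> 33671/5000 - 12/25 * \<rho>"
    if "1201/100 \<le> \<rho>" "\<rho> \<le> 1399/100"
  proof -
    have "hole \<rho> / 14 \<le> hole \<rho> / \<rho>"
      using that plateau_bounds[of 4 "1201/100" "1/50" "99/50" \<rho>] by (intro frac_le) auto
    moreover have "- hole' \<rho> - hole \<rho> / 14 \<le> 4847/5000 - 12/25 * (\<rho> - 1201/100)"
      using neck_bound[of "\<rho> - 1201/100"] that by (simp add: plateau_fall)
    ultimately show ?thesis by (simp add: algebra_simps)
  qed
qed

lemma rim_flux: "\<bar>rim' \<rho> + rim \<rho> / \<rho>\<bar> \<le> 1/2"
proof (cases "\<rho> \<le> 40")
  case True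
  have "0 \<le> rim' \<rho> + rim \<rho> / \<rho>" "rim' \<rho> + rim \<rho> / \<rho> \<le> 1/3 + 1/28"
    using plateau_radial_flux_rise[of 28 40 3 6 \<rho>] True by simp_all
  then show ?thesis by linarith
next
  case False
  have "0 \<le> rim \<rho> / \<rho>" "rim \<rho> / \<rho> \<le> 1/28"
    using plateau_div_bounds[of 28 40 3 6 \<rho>] by simp_all
  moreover have "-1/3 \<le> rim' \<rho>" "rim' \<rho> \<le> 0"
    using False tent_nonneg[of 3 6 "\<rho> - 40"] tent_le[of 3 6 "\<rho> - 40"]
    by (simp_all add: plateau_fall)
  ultimately show ?thesis by linarith
qed

lemma calibration_field:
  shows "C1c_field calibration"
    and "divergence calibration x = (rim' (norm x) + rim (norm x) / norm x)
      - (hole' (norm (x - left_centre)) + hole (norm (x - left_centre)) / norm (x - left_centre))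
      - (hole' (norm (x - right_centre)) + hole (norm (x - right_centre)) / norm (x - right_centre))"
proof -
  note H = C1c_field_radial_plateau[of 4 "1201/100" "1/50" "99/50", simplified]
  note R = C1c_field_radial_plateau[of 28 40 3 6 0, simplified]
  note RL = C1c_field_diff[OF R(1) H(1)[of left_centre]]
  have e: "calibration = (\<lambda>x. radial rim 0 x - radial hole left_centre x - radial hole right_centre x)"
    by (simp add: fun_eq_iff calibration_def)
  show "C1c_field calibration" unfolding e by (rule C1c_field_diff[OF RL(1) H(1)])
  show "divergence calibration x = (rim' (norm x) + rim (norm x) / norm x)
      - (hole' (norm (x - left_centre)) + hole (norm (x - left_centre)) / norm (x - left_centre))
      - (hole' (norm (x - right_centre)) + hole (norm (x - right_centre)) / norm (x - right_centre))"
    unfolding e C1c_field_diff(2)[OF RL(1) H(1)] RL(2) H(2) R(2) ..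
qed

lemma calibration_divergence: "\<bar>divergence calibration x\<bar> \<le> 99/100"
proof -
  define a b where "a = norm (x - left_centre)" and "b = norm (x - right_centre)"
  note dist = center_distances[of x, folded a_def b_def]
  note div = calibration_field(2)[of x, folded a_def b_def]
  show ?thesis
  proof (cases "norm x \<le> 28")
    case False
    then have "1399/100 \<le> a" "1399/100 \<le> b" using dist by auto
    then show ?thesis using div rim_flux[of "norm x"] by (simp add: hole_flux(4))
  next
    case True
    then have r: "rim' (norm x) + rim (norm x) / norm x = 0" by (simp add: plateau_low)
    define A B where "A = hole' a + hole a / a" and "B = hole' b + hole b / b"
    note A = hole_flux[of a, folded A_def] and B = hole_flux[of b, folded B_def]
    have "divergence calibration x = - A - B" using div r by (simp add: A_def B_def)
    moreover have "- 99/100 \<le> A + B \<and> A + B \<le> 99/100"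
    proof -
      consider (1) "a \<le> 1201/100" "1399/100 \<le> b" | (2) "b \<le> 1201/100" "1399/100 \<le> a"
        | (3) "1399/100 \<le> a" "1399/100 \<le> b"
        | (4) "1201/100 \<le> a" "a \<le> 1399/100" "1399/100 \<le> b"
        | (5) "1201/100 \<le> b" "b \<le> 1399/100" "1399/100 \<le> a"
        | (6) "1201/100 \<le> a" "a \<le> 1399/100" "1201/100 \<le> b" "b \<le> 1399/100"
        using dist(1) by linarith
      then show ?thesis
      proof cases
        case 1
        then show ?thesis using A(1) B(4) by simp
      next
        case 2
        then show ?thesis using A(4) B(1) by simp
      next
        case 3
        then show ?thesis using A(4) B(4) by simp
      next
        case 4
        then show ?thesis
          using A(2)[OF 4(1,2)] A(3)[OF 4(1)] B(4)[OF 4(3)] by linarith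
      next
        case 5
        then show ?thesis
          using B(2)[OF 5(1,2)] B(3)[OF 5(1)] A(4)[OF 5(3)] by linarith
      next
        case 6
        then show ?thesis
          using A(2)[OF 6(1,2)] A(3)[OF 6(1)] B(2)[OF 6(3,4)] B(3)[OF 6(3)] dist(1) by linarith
      qed
    qed
    ultimately show ?thesis by linarith
  qed
qed

text \<open>The only delicate place is the region where both hole fields are active; there the triangle
  inequality suffices, since the two profiles have sum at most 1.\<close>

lemma calibration_norm: "norm (calibration x) \<le> 1"
proof -
  define a b where "a = norm (x - left_centre)" and "b = norm (x - right_centre)"
  note dist = center_distances[of x, folded a_def b_def]
  have "norm (calibration x)
      \<le> norm (radial rim 0 x) + norm (radial hole left_centre x) + norm (radial hole right_centre x)"
    unfolding calibration_def by (meson add_mono norm_triangle_ineq4 order_refl order_trans)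
  also have "\<dots> \<le> \<bar>rim (norm x)\<bar> + \<bar>hole a\<bar> + \<bar>hole b\<bar>"
    unfolding a_def b_def
    using norm_radial[of rim 0 x] norm_radial[of hole left_centre x] norm_radial[of hole right_centre x] by simp
  also have "\<dots> = rim (norm x) + hole a + hole b" by (simp add: plateau_bounds)
  also have "\<dots> \<le> 1"
  proof (cases "norm x \<le> 28")
    case False
    then have "1399/100 \<le> a" "1399/100 \<le> b" using dist by auto
    then show ?thesis by (simp add: plateau_high plateau_bounds)
  next
    case True
    then have r: "rim (norm x) = 0" by (simp add: plateau_low)
    consider "a \<le> 1201/100" "1399/100 \<le> b" | "b \<le> 1201/100" "1399/100 \<le> a"
      | "1201/100 \<le> a" "1201/100 \<le> b"
      using dist(1) by linarith
    then show ?thesis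
    proof cases
      case 3
      have "1 \<le> step (1/50) (99/50) (a - 1201/100) + step (1/50) (99/50) (b - 1201/100)"
        using 3 dist(1) by (intro step_add_step_ge_1) auto
      then show ?thesis using 3 r by (simp add: plateau_fall)
    qed (simp_all add: r plateau_high plateau_bounds)
  qed
  finally show ?thesis .
qed

lemma calibration_at_rim:
  assumes "34 \<le> norm x" "norm x \<le> 40"
  shows "calibration x = (1 / norm x) *\<^sub>R x"
  using assms center_distances[of x] by (simp add: calibration_def radial_def plateau_high plateau_flat)

lemma calibration_at_left_hole:
  assumes "10 \<le> norm (x - left_centre)" "norm (x - left_centre) \<le> 1201/100"
  shows "calibration x = - (1 / norm (x - left_centre)) *\<^sub>R (x - left_centre)"
  using assms center_distances[of x] by (simp add: calibration_def radial_def plateau_high plateau_flat plateau_low)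

lemma calibration_at_right_hole:
  assumes "10 \<le> norm (x - right_centre)" "norm (x - right_centre) \<le> 1201/100"
  shows "calibration x = - (1 / norm (x - right_centre)) *\<^sub>R (x - right_centre)"
  using assms center_distances[of x] by (simp add: calibration_def radial_def plateau_high plateau_flat plateau_low)

lemma set_integral_pierced_disc:
  fixes f :: "real \<times> real \<Rightarrow> real"
  assumes f: "integrable lebesgue f"
  shows "(LINT x:pierced_disc|lebesgue. f x) = (LINT x:ball 0 40|lebesgue. f x)
    - (LINT x:ball left_centre (1201/100)|lebesgue. f x) - (LINT x:ball right_centre (1201/100)|lebesgue. f x)"
proof -
  have i: "integrable lebesgue (\<lambda>x. indicator (ball c r) x *\<^sub>R f x)" for c :: "real \<times> real" and r
    by (rule integrable_mult_indicator[OF _ f]) simp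
  have e: "indicat_real pierced_disc x
      = indicator (ball 0 40) x - indicator (ball left_centre (1201/100)) x
        - indicator (ball right_centre (1201/100)) x" for x
    using center_distances[of x] by (auto simp: pierced_disc_def indicator_def dist_norm norm_minus_commute)
  show ?thesis
    unfolding set_lebesgue_integral_def e scaleR_diff_left using i by simp
qed

text \<open>The divergence of \<open>calibration - \<psi>\<close> is integrated over the large disc and over the two holes
  separately. Since \<open>\<psi>\<close> is nowhere longer than the unit normal, this field points outward on the rim
  and into the holes.\<close>

lemma pierced_disc_calibrated:
  assumes \<psi>: "C1c_field \<psi>" "\<And>x. norm (\<psi> x) \<le> 1"
  shows "(LINT x:pierced_disc|lebesgue. divergence \<psi> x) \<le> (LINT x:pierced_disc|lebesgue. divergence calibration x)"
proof -
  define \<Phi> where "\<Phi> = (\<lambda>x. calibration x - \<psi> x)"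
  have \<Phi>: "C1c_field \<Phi>" "\<And>x. divergence \<Phi> x = divergence calibration x - divergence \<psi> x"
    unfolding \<Phi>_def by (rule C1c_field_diff[OF calibration_field(1) \<psi>(1)])+
  note neg = C1c_field_uminus[OF \<Phi>(1)]
  have cs: "\<bar>v \<bullet> \<psi> x\<bar> \<le> norm v" for v x
    using Cauchy_Schwarz_ineq2[of v "\<psi> x"] mult_left_le[OF \<psi>(2), of "norm v" x] by simp
  have unit: "v \<bullet> ((1 / norm v) *\<^sub>R v) = norm v" for v :: "real \<times> real"
    by (simp add: dot_square_norm power2_eq_square)
  have rim: "0 \<le> x \<bullet> \<Phi> x" if "34 \<le> norm x" "norm x \<le> 40" for x
    using cs[of x x] unit[of x] unfolding \<Phi>_def calibration_at_rim[OF that] inner_diff_right by linarith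
  have hole: "0 \<le> (x - c) \<bullet> (- \<Phi> x)" if "calibration x = - (1 / norm (x - c)) *\<^sub>R (x - c)" for x c
    using cs[of "x - c" x] unit[of "x - c"]
    unfolding \<Phi>_def that inner_diff_right inner_minus_right scaleR_minus_left by linarith
  have "0 \<le> (LINT x:ball 0 40|lebesgue. divergence \<Phi> x)"
    by (rule integral_divergence_ball_nonneg[where \<rho>\<^sub>0 = 34, OF \<Phi>(1)]) (use rim in auto)
  moreover have "0 \<le> (LINT x:ball left_centre (1201/100)|lebesgue. divergence (\<lambda>x. - \<Phi> x) x)"
    by (rule integral_divergence_ball_nonneg[where \<rho>\<^sub>0 = 10, OF neg(1)])
       (simp, simp, rule hole, rule calibration_at_left_hole)
  moreover have "0 \<le> (LINT x:ball right_centre (1201/100)|lebesgue. divergence (\<lambda>x. - \<Phi> x) x)"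
    by (rule integral_divergence_ball_nonneg[where \<rho>\<^sub>0 = 10, OF neg(1)])
       (simp, simp, rule hole, rule calibration_at_right_hole)
  ultimately have "0 \<le> (LINT x:pierced_disc|lebesgue. divergence \<Phi> x)"
    using set_integral_pierced_disc[OF integrable_divergence_lebesgue[OF \<Phi>(1)]]
    by (simp add: neg set_lebesgue_integral_def)
  also have "\<dots> = (LINT x:pierced_disc|lebesgue. divergence calibration x) - (LINT x:pierced_disc|lebesgue. divergence \<psi> x)"
    unfolding \<Phi>(2)
    by (intro set_integral_diff set_integrable_divergence calibration_field \<psi>) (auto simp: pierced_disc_def)
  finally show ?thesis by simp
qed

section \<open>The neck is not covered by unit balls\<close>

lemma ball_avoids_hole:
  fixes c :: "'a::euclidean_space"
  assumes "ae_subset (ball x R) A" "A \<inter> ball c r = {}" "0 < R" "0 < r"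
  shows "R + r \<le> dist x c"
proof (rule ccontr)
  assume "\<not> R + r \<le> dist x c"
  moreover define y where "y = x + (R / (R + r)) *\<^sub>R (c - x)"
  moreover have "dist x y = R / (R + r) * dist x c"
    using assms(3,4) by (simp add: y_def dist_norm norm_minus_commute)
  moreover have "c - y = (r / (R + r)) *\<^sub>R (c - x)"
  proof -
    have "r / (R + r) = 1 - R / (R + r)" using assms(3,4) by (simp add: field_simps)
    moreover have "c - y = (1 - R / (R + r)) *\<^sub>R (c - x)" unfolding y_def by (simp add: scaleR_diff_left)
    ultimately show ?thesis by simp
  qed
  then have "dist c y = r / (R + r) * dist x c"
    using assms(3,4) by (simp add: dist_norm norm_minus_commute)
  moreover have "k / (R + r) * dist x c < k" if "0 < k" for k
    using mult_strict_left_mono[of "dist x c" "R + r" "k / (R + r)"] that assms(3,4)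
      \<open>\<not> R + r \<le> dist x c\<close> by simp
  ultimately have "dist x y < R" "dist c y < r"
    using assms(3,4) by simp_all
  then have "ball x R \<inter> ball c r \<noteq> {}" by auto
  moreover have "ball x R \<inter> ball c r \<subseteq> ball x R - A" using assms(2) by blast
  then have "negligible (ball x R \<inter> ball c r)"
    using assms(1) unfolding ae_subset_def negligible_iff_null_sets[symmetric] by (rule negligible_subset[rotated])
  ultimately show False using open_not_negligible[of "ball x R \<inter> ball c r"] by (simp add: open_Int)
qed

text \<open>The disc lies next to the left hole on the axis. A unit ball that avoids the left hole and covers a
  point near the point of the hole closest to the right one has its centre close to
  \<open>(r + 1 - 13, 0)\<close>, at distance about \<open>r + w - 1\<close> from the right centre. This is less than \<open>r + 1\<close>, so
  the ball meets the right hole.\<close>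

lemma neck_uncovered:
  assumes p: "p \<in> ball (-988/1000, 0) (2/1000)" and x: "p \<in> ball x 1" "ae_subset (ball x 1) pierced_disc"
  shows False
proof -
  have disj: "pierced_disc \<inter> ball left_centre (1201/100) = {}" "pierced_disc \<inter> ball right_centre (1201/100) = {}"
    by (auto simp: pierced_disc_def)
  then have d: "1 + 1201/100 \<le> dist x left_centre" "1 + 1201/100 \<le> dist x right_centre"
    using ball_avoids_hole[OF x(2) disj(1)] ball_avoids_hole[OF x(2) disj(2)] by simp_all
  obtain y z where x_eq: "x = (y, z)" by (cases x)
  have "dist x (-988/1000, 0) < 1002/1000"
    using dist_triangle[of x "(-988/1000, 0)" p] p x by (simp add: dist_commute)
  then have "(dist x (-988/1000, 0))\<^sup>2 < (1002/1000)\<^sup>2" by (intro power_strict_mono) auto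
  then have 1: "(y + 988/1000)\<^sup>2 + z\<^sup>2 < (1002/1000)\<^sup>2"
    by (simp add: x_eq dist_Pair_Pair dist_real_def)
  have "(1301/100)\<^sup>2 \<le> (dist x left_centre)\<^sup>2" "(1301/100)\<^sup>2 \<le> (dist x right_centre)\<^sup>2"
    using d by (auto intro!: power_mono)
  then have "(1301/100)\<^sup>2 \<le> (y + 13)\<^sup>2 + z\<^sup>2" "(1301/100)\<^sup>2 \<le> (y - 13)\<^sup>2 + z\<^sup>2"
    by (simp_all add: x_eq left_centre_def right_centre_def dist_Pair_Pair dist_real_def)
  with 1 show False by (simp add: power2_eq_square algebra_simps)
qed

lemma neck_subset_pierced_disc: "ball (-988/1000, 0) (2/1000) \<subseteq> pierced_disc"
proof
  fix p :: "real \<times> real" assume p: "p \<in> ball (-988/1000, 0) (2/1000)"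
  define m :: "real \<times> real" where "m = (-988/1000, 0)"
  have m: "dist 0 m = 988/1000" "dist left_centre m = 12012/1000" "dist right_centre m = 13988/1000"
    by (simp_all add: m_def left_centre_def right_centre_def dist_norm norm_Pair)
  have "dist m p < 2/1000" using p by (simp add: m_def)
  moreover have "dist 0 p \<le> dist 0 m + dist m p" "dist left_centre m \<le> dist left_centre p + dist m p"
    "dist right_centre m \<le> dist right_centre p + dist m p"
    by (metis dist_triangle dist_commute)+
  ultimately show "p \<in> pierced_disc" unfolding pierced_disc_def m by auto
qed

theorem mainTheorem1:
  "\<exists>(\<Omega> :: (real \<times> real) set) (lam :: real).
     bounded \<Omega> \<and> \<Omega> \<in> sets lebesgue \<and> lam > 0 \<and>
     (\<forall>S \<in> sets lebesgue. emeasure lebesgue (sym_diff S \<Omega>) > 0 \<longrightarrow>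
        L1TV_energy \<Omega> lam \<Omega> < L1TV_energy \<Omega> lam S) \<and>
     emeasure lebesgue (\<Omega> - \<Union>{ball x (1 / lam) | x. ae_subset (ball x (1 / lam)) \<Omega>}) > 0"
proof (intro exI[of _ pierced_disc] exI[of _ 1] conjI ballI impI)
  show "bounded pierced_disc" unfolding pierced_disc_def by (rule bounded_subset[OF bounded_ball[of 0 40]]) auto
  show dom: "pierced_disc \<in> sets lebesgue" by (simp add: pierced_disc_def)
  show "L1TV_energy pierced_disc 1 pierced_disc < L1TV_energy pierced_disc 1 S"
    if "S \<in> sets lebesgue" "emeasure lebesgue (sym_diff S pierced_disc) > 0" for S
    by (rule calibrated_set_is_strict_minimizer[OF calibration_field(1) calibration_norm calibration_divergence
          _ dom pierced_disc_calibrated that]) auto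
  let ?U = "\<Union>{ball x (1 / 1) | x. ae_subset (ball x (1 / 1)) pierced_disc}"
  have sub: "ball (-988/1000, 0) (2/1000) \<subseteq> pierced_disc - ?U"
    using neck_subset_pierced_disc neck_uncovered by fastforce
  have "open ?U" by auto
  then have "pierced_disc - ?U \<in> sets lebesgue" using dom by (intro sets.Diff) auto
  then have "emeasure lebesgue (ball (-988/1000, 0) (2/1000) :: (real \<times> real) set)
      \<le> emeasure lebesgue (pierced_disc - ?U)"
    by (rule emeasure_mono[OF sub])
  moreover have "0 < emeasure lebesgue (ball (-988/1000, 0) (2/1000) :: (real \<times> real) set)"
    using open_not_negligible[of "ball (-988/1000, 0) (2/1000) :: (real \<times> real) set"]
    by (auto simp: zero_less_iff_neq_zero negligible_iff_null_sets null_sets_def)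
  ultimately show "0 < emeasure lebesgue (pierced_disc - ?U)" by (rule less_le_trans[rotated])
qed simp_all

end
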